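(* Consider the disjunctive constraint $\bigvee_{l\in\mathcal D}\big[\,\sum_{i=1}^nh_{i,k}(x_i)\le b_{l,k}\ \forall k\in\mathcal C_l,\ \boldsymbol x\in\mathcal X\,\big]$. If all $h_{i,k}$ are affine and $\mathcal X\subset\mathbb R^n$ is a bounded box defined by lower and upper bounds on all variables, then the continuous relaxation of the $n$-split formulation (all constraints are split for each variable) results in the convex hull of the disjunction: its projection onto the $\boldsymbol x$-space equals the convex hull of $\bigcup_{l\in\mathcal D}\{\boldsymbol x\in\mathcal X:\sum_{i=1}^nh_{i,k}(x_i)\le b_{l,k}\ \forall k\in\mathcal C_l\}$.
   Context: Setting. $\mathcal D$ is a finite set of disjunct indices, $\mathcal C_l$ is the finite set of constraint indices of disjunct $l\in\mathcal D$, $b_{l,k}\in\mathbb R$, and each disjunct $\{\boldsymbol x\in\mathcal X:\sum_{i=1}^nh_{i,k}(x_i)\le b_{l,k}\ \forall k\in\mathcal C_l\}$ is non-empty. $n$-split formulation. In general a $P$-split formulation partitions the variables into $P$ groups, represents each partial sum of a constraint over a group by an auxiliary variable $\alpha$ (bounded by the minimum and maximum of that partial sum over $\mathcal X$), rewrites the disjunction in terms of linear constraints and bounds on the $\alpha$-variables, and uses the extended convex hull formulation of that linear disjunction, while the relations between $\boldsymbol x$ and $\alpha$ are kept as global constraints. $P$-split formulations are implemented with the minimal number of auxiliary variables: if the same or a scaled partial sum appears in several constraints or disjuncts, a single auxiliary variable is used for it; for affine partial sums the relation between $\alpha$ and $\boldsymbol x$ is an equality. Consequently, writing $h_{i,k}(x_i)=a_{i,k}x_i+c_{i,k}$,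 the $n$-split formulation (every variable is its own group) uses one auxiliary variable $\alpha_i=\gamma_ix_i$ per coordinate, with a fixed $\gamma_i\ne0$, and bounds $\underline\alpha_i=\min_{\boldsymbol x\in\mathcal X}\gamma_ix_i$, $\bar\alpha_i=\max_{\boldsymbol x\in\mathcal X}\gamma_ix_i$. It consists of: $\boldsymbol x\in\mathcal X$; for all $i\in\{1,\dots,n\}$ and $d\in\mathcal D$, $$\alpha_i=\gamma_ix_i,\qquad \alpha_i=\sum_{d'\in\mathcal D}\nu_{i,d'},\qquad \underline\alpha_i\lambda_d\le\nu_{i,d}\le\bar\alpha_i\lambda_d;$$ for all $d\in\mathcal D$ and $k\in\mathcal C_d$, $\ \sum_{i=1}^n\frac{a_{i,k}}{\gamma_i}\,\nu_{i,d}\le\big(b_{d,k}-\sum_{i=1}^nc_{i,k}\big)\lambda_d$; and $\sum_{d\in\mathcal D}\lambda_d=1$, $\boldsymbol\lambda\in\{0,1\}^{|\mathcal D|}$. Its continuous relaxation replaces $\boldsymbol\lambda\in\{0,1\}^{|\mathcal D|}$ by $\boldsymbol\lambda\in[0,1]^{|\mathcal D|}$. *)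

theory Defs
  imports "HOL-Analysis.Analysis"
begin

(* The summands depend on the constraint index k only, while the right-hand side
   also depends on the disjunct l. Indices k may be shared between disjuncts. *)
definition disjunct ::
  "(real ^ 'n) set \<Rightarrow> ('d \<Rightarrow> 'k set) \<Rightarrow> ('n::finite \<Rightarrow> 'k \<Rightarrow> real \<Rightarrow> real) \<Rightarrow>
   ('d \<Rightarrow> 'k \<Rightarrow> real) \<Rightarrow> 'd \<Rightarrow> (real ^ 'n) set"
  where "disjunct X C h b l = {x \<in> X. \<forall>k\<in>C l. (\<Sum>i\<in>UNIV. h i k (x $ i)) \<le> b l k}"

(* Inf and Sup are the minimum and maximum when X is compact and non-empty,
   in particular when X is a non-empty bounded box. *)
definition alpha_lb :: "(real ^ 'n) set \<Rightarrow> ('n::finite \<Rightarrow> real) \<Rightarrow> 'n \<Rightarrow> real"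
  where "alpha_lb X \<gamma> i = (INF x\<in>X. \<gamma> i * x $ i)"

definition alpha_ub :: "(real ^ 'n) set \<Rightarrow> ('n::finite \<Rightarrow> real) \<Rightarrow> 'n \<Rightarrow> real"
  where "alpha_ub X \<gamma> i = (SUP x\<in>X. \<gamma> i * x $ i)"

(* Feasible points (x, \<alpha>, \<nu>, lam) of the n-split formulation for affine summands
   h i k t = a i k * t + c i k, where each lam d ranges over the set V. The values of
   \<nu> and lam outside D are unconstrained and irrelevant. *)
definition n_split_over ::
  "real set \<Rightarrow> (real ^ 'n) set \<Rightarrow> 'd set \<Rightarrow> ('d \<Rightarrow> 'k set) \<Rightarrow>
   ('n::finite \<Rightarrow> 'k \<Rightarrow> real) \<Rightarrow> ('n \<Rightarrow> 'k \<Rightarrow> real) \<Rightarrow> ('d \<Rightarrow> 'k \<Rightarrow> real) \<Rightarrow> ('n \<Rightarrow> real) \<Rightarrow>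
   ((real ^ 'n) \<times> ('n \<Rightarrow> real) \<times> ('n \<Rightarrow> 'd \<Rightarrow> real) \<times> ('d \<Rightarrow> real)) set"
  where "n_split_over V X D C a c b \<gamma> =
    {(x, \<alpha>, \<nu>, lam).
       x \<in> X \<and>
       (\<forall>i. \<alpha> i = \<gamma> i * x $ i) \<and>
       (\<forall>i. \<alpha> i = (\<Sum>d\<in>D. \<nu> i d)) \<and>
       (\<forall>i. \<forall>d\<in>D. alpha_lb X \<gamma> i * lam d \<le> \<nu> i d \<and> \<nu> i d \<le> alpha_ub X \<gamma> i * lam d) \<and>
       (\<forall>d\<in>D. \<forall>k\<in>C d.
          (\<Sum>i\<in>UNIV. a i k / \<gamma> i * \<nu> i d) \<le> (b d k - (\<Sum>i\<in>UNIV. c i k)) * lam d) \<and>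
       (\<Sum>d\<in>D. lam d) = 1 \<and>
       (\<forall>d\<in>D. lam d \<in> V)}"

definition n_split_formulation where
  "n_split_formulation = n_split_over {0, 1}"

definition n_split_relaxation where
  "n_split_relaxation = n_split_over {0..1}"

end

theory Submission
  imports Defs
begin

text \<open>
  The relaxation is the extended formulation of a union of polytopes obtained from disjunctive
  programming. Rescaling coordinate \<open>i\<close> by \<open>\<gamma> i\<close> is invertible, so the auxiliary variables are just
  the coordinates of \<open>x\<close> in other units, and the constraints that involve one disjunct \<open>d\<close> form the
  homogenisation of that disjunct: for \<open>lam d > 0\<close> they say that \<open>\<nu> _ d\<close>, divided by \<open>lam d\<close>, is the
  rescaled image of a point of the disjunct.

  Two features make the formulation exact. First, an affine constraint is again a linear constraint
  in the \<open>\<alpha>\<close>-variables, and their bounds describe \<open>X\<close> itself, because \<open>X\<close> is a box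
  (\<open>alpha_bounds_iff_box\<close>). Secondly, these bounds are finite, so \<open>lam d = 0\<close> forces \<open>\<nu> _ d = 0\<close>,
  and disjuncts with weight zero contribute no recession directions. Together they give
  \<open>homogenised_disjunct_iff\<close>: the copies \<open>\<nu> _ d\<close> are precisely the vectors \<open>lam d\<close> times a rescaled
  point of disjunct \<open>d\<close>. Summing over \<open>d\<close>, the projection consists of the convex combinations that
  take one point from each disjunct, and this is the convex hull of the union because every disjunct
  is convex and non-empty.
\<close>

lemma disjunct_affine:
  fixes X :: "(real ^ 'n::finite) set"
  assumes "\<And>i k t. k \<in> C l \<Longrightarrow> h i k t = a i k * t + c i k"
  shows "disjunct X C h b l =
    {x \<in> X. \<forall>k\<in>C l. (\<Sum>i\<in>UNIV. a i k * x $ i) \<le> b l k - (\<Sum>i\<in>UNIV. c i k)}"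
proof -
  have "(\<Sum>i\<in>UNIV. h i k (x $ i)) = (\<Sum>i\<in>UNIV. a i k * x $ i) + (\<Sum>i\<in>UNIV. c i k)"
    if "k \<in> C l" for k and x :: "real ^ 'n"
    using that by (simp add: assms sum.distrib)
  then show ?thesis
    unfolding disjunct_def by (auto simp: le_diff_eq)
qed

lemma convex_disjunct_affine:
  fixes X :: "(real ^ 'n::finite) set"
  assumes "\<And>i k t. k \<in> C l \<Longrightarrow> h i k t = a i k * t + c i k" and "convex X"
  shows "convex (disjunct X C h b l)"
proof -
  have "disjunct X C h b l =
    X \<inter> (\<Inter>k\<in>C l. {x. (\<chi> i. a i k) \<bullet> x \<le> b l k - (\<Sum>i\<in>UNIV. c i k)})"
    by (subst disjunct_affine[of C l h a c]) (auto simp: assms(1) inner_vec_def)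
  then show ?thesis
    by (auto intro!: convex_Int convex_INT convex_halfspace_le \<open>convex X\<close>)
qed

text \<open>
  Each of the two bounds is attained at the corner \<open>lo\<close> or at the corner \<open>up\<close>, depending on the sign
  of the scaling factor.
\<close>

lemma alpha_bounds_cbox:
  fixes lo up :: "real ^ 'n::finite"
  assumes "cbox lo up \<noteq> {}"
  shows "alpha_lb (cbox lo up) \<gamma> i = min (\<gamma> i * lo $ i) (\<gamma> i * up $ i)"
    and "alpha_ub (cbox lo up) \<gamma> i = max (\<gamma> i * lo $ i) (\<gamma> i * up $ i)"
proof -
  have corners: "lo \<in> cbox lo up" "up \<in> cbox lo up"
    using assms by (auto simp: interval_ne_empty_cart mem_box_cart)
  have attained: "\<gamma> i * lo $ i \<in> (\<lambda>x. \<gamma> i * x $ i) ` cbox lo up"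
    "\<gamma> i * up $ i \<in> (\<lambda>x. \<gamma> i * x $ i) ` cbox lo up"
    using corners by auto
  have between: "min (\<gamma> i * lo $ i) (\<gamma> i * up $ i) \<le> \<gamma> i * x $ i \<and>
      \<gamma> i * x $ i \<le> max (\<gamma> i * lo $ i) (\<gamma> i * up $ i)" if "x \<in> cbox lo up" for x
    using that by (cases "0 \<le> \<gamma> i")
      (auto simp: mem_box_cart min_le_iff_disj le_max_iff_disj intro: mult_left_mono mult_left_mono_neg)
  show "alpha_lb (cbox lo up) \<gamma> i = min (\<gamma> i * lo $ i) (\<gamma> i * up $ i)"
    unfolding alpha_lb_def
    using attained between by (intro cInf_eq_minimum) (auto simp: min_def)
  show "alpha_ub (cbox lo up) \<gamma> i = max (\<gamma> i * lo $ i) (\<gamma> i * up $ i)"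
    unfolding alpha_ub_def
    using attained between by (intro cSup_eq_maximum) (auto simp: max_def)
qed

lemma alpha_bounds_iff_box:
  fixes lo up :: "real ^ 'n::finite"
  assumes "cbox lo up \<noteq> {}" and "\<gamma> i \<noteq> 0"
  shows "alpha_lb (cbox lo up) \<gamma> i \<le> \<gamma> i * t \<and> \<gamma> i * t \<le> alpha_ub (cbox lo up) \<gamma> i \<longleftrightarrow>
    lo $ i \<le> t \<and> t \<le> up $ i"
proof -
  have "lo $ i \<le> up $ i"
    using assms(1) by (auto simp: interval_ne_empty_cart)
  then show ?thesis
    using assms(2) unfolding alpha_bounds_cbox[OF assms(1)]
    by (cases "0 < \<gamma> i") (auto simp: min_le_iff_disj le_max_iff_disj)
qed

text \<open>
  For a non-empty disjunct of a box, and up to the rescaling of coordinates, the solutions \<open>(\<nu>, w)\<close>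
  with \<open>w \<ge> 0\<close> form the cone over \<open>disjunct \<times> {1}\<close>. Once these systems are isolated, the disjuncts
  are coupled only through the sums of their copies and of their weights.
\<close>

definition homogenised_disjunct ::
  "(real ^ 'n) set \<Rightarrow> ('d \<Rightarrow> 'k set) \<Rightarrow> ('n::finite \<Rightarrow> 'k \<Rightarrow> real) \<Rightarrow> ('n \<Rightarrow> 'k \<Rightarrow> real) \<Rightarrow>
   ('d \<Rightarrow> 'k \<Rightarrow> real) \<Rightarrow> ('n \<Rightarrow> real) \<Rightarrow> 'd \<Rightarrow> ('n \<Rightarrow> real) \<Rightarrow> real \<Rightarrow> bool"
  where "homogenised_disjunct X C a c b \<gamma> d \<nu> w \<longleftrightarrow>
    (\<forall>i. alpha_lb X \<gamma> i * w \<le> \<nu> i \<and> \<nu> i \<le> alpha_ub X \<gamma> i * w) \<and>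
    (\<forall>k\<in>C d. (\<Sum>i\<in>UNIV. a i k / \<gamma> i * \<nu> i) \<le> (b d k - (\<Sum>i\<in>UNIV. c i k)) * w)"

text \<open>
  All constraints of the homogenised system are homogeneous linear in \<open>(\<nu>, w)\<close>, so a positive weight can be
  divided out of every one of them.
\<close>

lemma homogenised_disjunct_scaled_iff:
  fixes lo up :: "real ^ 'n::finite"
  assumes "cbox lo up \<noteq> {}" and "\<And>i. \<gamma> i \<noteq> 0"
    and "\<And>i k t. k \<in> C d \<Longrightarrow> h i k t = a i k * t + c i k"
    and "0 < w"
  shows "homogenised_disjunct (cbox lo up) C a c b \<gamma> d (\<lambda>i. w * (\<gamma> i * s $ i)) w \<longleftrightarrow>
    s \<in> disjunct (cbox lo up) C h b d"
proof -
  have bounds: "alpha_lb (cbox lo up) \<gamma> i * w \<le> w * (\<gamma> i * s $ i) \<and>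
      w * (\<gamma> i * s $ i) \<le> alpha_ub (cbox lo up) \<gamma> i * w \<longleftrightarrow> lo $ i \<le> s $ i \<and> s $ i \<le> up $ i" for i
    using alpha_bounds_iff_box[OF assms(1), of \<gamma> i "s $ i"] assms(2)[of i] \<open>0 < w\<close>
    by (metis mult.commute mult_le_cancel_left_pos)
  have "(\<Sum>i\<in>UNIV. a i k / \<gamma> i * (w * (\<gamma> i * s $ i))) = (\<Sum>i\<in>UNIV. a i k * s $ i) * w" for k
    using assms(2) by (simp add: sum_distrib_left ac_simps)
  then have rows: "(\<Sum>i\<in>UNIV. a i k / \<gamma> i * (w * (\<gamma> i * s $ i))) \<le> (b d k - (\<Sum>i\<in>UNIV. c i k)) * w \<longleftrightarrow>
      (\<Sum>i\<in>UNIV. a i k * s $ i) \<le> b d k - (\<Sum>i\<in>UNIV. c i k)" for k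
    using \<open>0 < w\<close> by simp
  have "s \<in> disjunct (cbox lo up) C h b d \<longleftrightarrow>
      s \<in> cbox lo up \<and> (\<forall>k\<in>C d. (\<Sum>i\<in>UNIV. a i k * s $ i) \<le> b d k - (\<Sum>i\<in>UNIV. c i k))"
    by (subst disjunct_affine[of C d h a c]) (use assms(3) in auto)
  then show ?thesis
    unfolding homogenised_disjunct_def bounds rows by (simp add: mem_box_cart)
qed

text \<open>
  At weight zero the bounds leave only \<open>\<nu> = 0\<close>, which is zero times any point of the disjunct,
  so the equivalence there rests on the disjunct having a point at all.
\<close>

lemma homogenised_disjunct_iff:
  fixes lo up :: "real ^ 'n::finite"
  assumes nonempty: "disjunct (cbox lo up) C h b d \<noteq> {}" and \<gamma>: "\<And>i. \<gamma> i \<noteq> 0"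
    and affine: "\<And>i k t. k \<in> C d \<Longrightarrow> h i k t = a i k * t + c i k"
    and "0 \<le> w"
  shows "homogenised_disjunct (cbox lo up) C a c b \<gamma> d \<nu> w \<longleftrightarrow>
    (\<exists>s\<in>disjunct (cbox lo up) C h b d. \<nu> = (\<lambda>i. w * (\<gamma> i * s $ i)))"
proof (cases "w = 0")
  case True
  then show ?thesis
    using nonempty by (auto simp: homogenised_disjunct_def fun_eq_iff intro: order.antisym)
next
  case False
  with \<open>0 \<le> w\<close> have "0 < w" by simp
  have box: "cbox lo up \<noteq> {}"
    using nonempty by (auto simp: disjunct_def)
  have unscale: "\<nu> = (\<lambda>i. w * (\<gamma> i * (\<chi> i. \<nu> i / (w * \<gamma> i)) $ i))"
    using \<gamma> \<open>0 < w\<close> by auto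
  note scaled = homogenised_disjunct_scaled_iff[of lo up \<gamma> C d h a c w b,
    OF box \<gamma> affine \<open>0 < w\<close>]
  show ?thesis
    using scaled unscale by metis
qed

lemma mem_n_split_relaxation_iff:
  "(x, \<alpha>, \<nu>, lam) \<in> n_split_relaxation X D C a c b \<gamma> \<longleftrightarrow>
     x \<in> X \<and> (\<forall>i. \<alpha> i = \<gamma> i * x $ i) \<and> (\<forall>i. \<gamma> i * x $ i = (\<Sum>d\<in>D. \<nu> i d)) \<and>
     (\<forall>d\<in>D. homogenised_disjunct X C a c b \<gamma> d (\<lambda>i. \<nu> i d) (lam d)) \<and>
     (\<Sum>d\<in>D. lam d) = 1 \<and> (\<forall>d\<in>D. lam d \<in> {0..1})"
  unfolding n_split_relaxation_def n_split_over_def homogenised_disjunct_def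
  by (auto simp del: atLeastAtMost_iff)

theorem theorem5:
  fixes X :: "(real ^ 'n::finite) set"
    and D :: "'d set"
    and C :: "'d \<Rightarrow> 'k set"
    and h :: "'n \<Rightarrow> 'k \<Rightarrow> real \<Rightarrow> real"
    and b :: "'d \<Rightarrow> 'k \<Rightarrow> real"
    and a c :: "'n \<Rightarrow> 'k \<Rightarrow> real"
    and \<gamma> :: "'n \<Rightarrow> real"
    and lo up :: "real ^ 'n"
  assumes "finite D"
    and "\<And>l. l \<in> D \<Longrightarrow> finite (C l)"
    and "X = cbox lo up"
    and "\<And>l. l \<in> D \<Longrightarrow> disjunct X C h b l \<noteq> {}"
    and "\<And>i l k t. l \<in> D \<Longrightarrow> k \<in> C l \<Longrightarrow> h i k t = a i k * t + c i k"
    and "\<And>i. \<gamma> i \<noteq> 0"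
  shows "fst ` n_split_relaxation X D C a c b \<gamma> = convex hull (\<Union>l\<in>D. disjunct X C h b l)"
proof -
  let ?S = "disjunct X C h b"
  have "convex X"
    using assms(3) by simp
  have convex: "convex (?S l)" if "l \<in> D" for l
    using that \<open>convex X\<close> by (intro convex_disjunct_affine[of C l h a c]) (auto simp: assms(5))
  have hull: "convex hull (\<Union>l\<in>D. ?S l) =
    {\<Sum>l\<in>D. w l *\<^sub>R s l | w s. (\<forall>l\<in>D. 0 \<le> w l) \<and> sum w D = 1 \<and> (\<forall>l\<in>D. s l \<in> ?S l)}"
    using convex assms(1,4) by (intro convex_hull_finite_union) auto
  have homogenised: "homogenised_disjunct X C a c b \<gamma> l \<nu> w \<longleftrightarrow>
      (\<exists>s\<in>?S l. \<nu> = (\<lambda>i. w * (\<gamma> i * s $ i)))" if "l \<in> D" "0 \<le> w" for l \<nu> w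
    unfolding assms(3)
    using that assms(4,5,6) by (intro homogenised_disjunct_iff) (auto simp: assms(3))
  show ?thesis
  proof (intro subset_antisym subsetI)
    fix x assume "x \<in> fst ` n_split_relaxation X D C a c b \<gamma>"
    then obtain \<alpha> \<nu> lam where "(x, \<alpha>, \<nu>, lam) \<in> n_split_relaxation X D C a c b \<gamma>"
      by auto
    then have split: "\<And>i. \<gamma> i * x $ i = (\<Sum>d\<in>D. \<nu> i d)"
      and copies: "\<And>d. d \<in> D \<Longrightarrow> homogenised_disjunct X C a c b \<gamma> d (\<lambda>i. \<nu> i d) (lam d)"
      and lam: "sum lam D = 1" "\<And>d. d \<in> D \<Longrightarrow> 0 \<le> lam d"
      unfolding mem_n_split_relaxation_iff by auto
    have "\<exists>s\<in>?S d. \<forall>i. \<nu> i d = lam d * (\<gamma> i * s $ i)" if "d \<in> D" for d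
      using copies[OF that] homogenised[OF that lam(2)[OF that]] by (simp add: fun_eq_iff)
    then obtain s where s: "\<And>d. d \<in> D \<Longrightarrow> s d \<in> ?S d"
        "\<And>d i. d \<in> D \<Longrightarrow> \<nu> i d = lam d * (\<gamma> i * s d $ i)"
      by metis
    have "\<gamma> i * x $ i = \<gamma> i * (\<Sum>d\<in>D. lam d *\<^sub>R s d) $ i" for i
      unfolding split using s(2) by (simp add: sum_distrib_left ac_simps)
    then have "x = (\<Sum>d\<in>D. lam d *\<^sub>R s d)"
      using assms(6) by (simp add: vec_eq_iff)
    then show "x \<in> convex hull (\<Union>l\<in>D. ?S l)"
      unfolding hull using lam s(1) by auto
  next
    fix x assume x: "x \<in> convex hull (\<Union>l\<in>D. ?S l)"
    then obtain w s where x_eq: "x = (\<Sum>l\<in>D. w l *\<^sub>R s l)"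
      and w: "\<And>l. l \<in> D \<Longrightarrow> 0 \<le> w l" "sum w D = 1"
      and s: "\<And>l. l \<in> D \<Longrightarrow> s l \<in> ?S l"
      unfolding hull by auto
    have "convex hull (\<Union>l\<in>D. ?S l) \<subseteq> X"
      using \<open>convex X\<close> by (intro hull_minimal) (auto simp: disjunct_def)
    with x have "x \<in> X" by blast
    have "w l \<le> 1" if "l \<in> D" for l
      using member_le_sum[of l D w] that w assms(1) by auto
    moreover have "homogenised_disjunct X C a c b \<gamma> l (\<lambda>i. w l * (\<gamma> i * s l $ i)) (w l)"
      if "l \<in> D" for l
      using homogenised[OF that w(1)[OF that]] s[OF that] by blast
    moreover have "\<gamma> i * x $ i = (\<Sum>l\<in>D. w l * (\<gamma> i * s l $ i))" for i
      unfolding x_eq by (simp add: sum_distrib_left ac_simps)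
    ultimately have "(x, \<lambda>i. \<gamma> i * x $ i, \<lambda>i l. w l * (\<gamma> i * s l $ i), w)
        \<in> n_split_relaxation X D C a c b \<gamma>"
      unfolding mem_n_split_relaxation_iff using \<open>x \<in> X\<close> w by auto
    then show "x \<in> fst ` n_split_relaxation X D C a c b \<gamma>"
      by (rule image_eqI[rotated]) simp
  qed
qed

end
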